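(* Let $A$ and $B$ be two networks (discrete Bass model) with $M$ nodes each, and let $\{t_i^A\}_{i=1}^M$ and $\{t_i^B\}_{i=1}^M$ be their inter-adoption times. Suppose that $\{t_i^A\}_{i=1}^M$ are independent nonnegative random variables, that $\{t_i^B\}_{i=1}^M$ are independent nonnegative random variables, that their cumulative distribution functions satisfy $$F_{t_i^A}(\tau)\le F_{t_i^B}(\tau),\qquad 1\le i\le M,\quad \tau\ge 0,$$ and that there exists at least one index $1\le j\le M$ for which $$F_{t_j^A}(\tau)<F_{t_j^B}(\tau),\qquad \tau>0.$$ Then the expected numbers of adopters satisfy $n_A(t)<n_B(t)$ for all $0<t<\infty$.
   Context: Discrete Bass model: a network has $M$ nodes, external rates $p_j\ge 0$ and internal rates $q_{i,j}\ge 0$ ($i\ne j$; the influence of $i$ on $j$). $X_j(t)\in\{0,1\}$ is the state of node $j$ ($1$ = adopter), $X_j(0)=0$ for all $j$. The process $(X_1,\dots,X_M)$ is a continuous-time Markov chain in which adopters remain adopters forever, and each nonadopter $j$ becomes an adopter at rate $p_j+\sum_{k\ne j}q_{k,j}X_k(t)$ (one node changes at a time). For a network $A$, $t_i^A$ is the time between the $(i-1)$th and the $i$th adoptions ($t_1^A$ is the time from $t=0$ to the first adoption; $t_i^A=\infty$ if the $i$th adoption never occurs). $F_{t}(\tau)=\mathrm{Prob}(t\le\tau)$. The time of the $m$th adoption is $T_m^A=t_1^A+\dots+t_m^A$, with $T_0^A=0$; the number of adopters is $N_A(t)=\max\{m\in\{0,\dots,M\}: T_m^A\le t\}$, and $n_A(t)=\mathbf{E}[N_A(t)]$.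 The same notation is used for $B$. *)

theory Defs
  imports "HOL-Probability.Probability"
begin

definition history :: "'w measure \<Rightarrow> (real \<Rightarrow> 'w \<Rightarrow> 's) \<Rightarrow> real \<Rightarrow> 'w measure" where
  "history \<Omega> X t = sigma (space \<Omega>) {X s -` B \<inter> space \<Omega> | s B. 0 \<le> s \<and> s \<le> t}"

text \<open>
  Time-homogeneous continuous-time Markov chain with state space \<open>S\<close> and generator \<open>Q\<close>.
  The last assumption says that, for a transition function \<open>P\<close> with
  \<open>P h x y = \<delta>\<^sub>x\<^sub>y + Q x y * h + o(h)\<close>, the conditional probability of \<open>X (t + h) = y\<close>, given
  \<open>X t = x\<close> and any event observable up to time \<open>t\<close>, is \<open>P h x y\<close>; the multiplicative form
  imposes nothing when the conditioning event is null.
\<close>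

locale ctmc = prob_space \<Omega> for \<Omega> :: "'w measure" +
  fixes S :: "'s set" and Q :: "'s \<Rightarrow> 's \<Rightarrow> real" and X :: "real \<Rightarrow> 'w \<Rightarrow> 's"
  assumes measurable_X: "t \<ge> 0 \<Longrightarrow> X t \<in> \<Omega> \<rightarrow>\<^sub>M count_space S"
    and right_continuous:
      "\<omega> \<in> space \<Omega> \<Longrightarrow> t \<ge> 0 \<Longrightarrow> eventually (\<lambda>s. X s \<omega> = X t \<omega>) (at_right t)"
    and markov:
      "\<exists>P :: real \<Rightarrow> 's \<Rightarrow> 's \<Rightarrow> real.
        (\<forall>x\<in>S. \<forall>y\<in>S. ((\<lambda>h. (P h x y - of_bool (x = y)) / h) \<longlongrightarrow> Q x y) (at_right 0)) \<and>
        (\<forall>t\<ge>0. \<forall>h\<ge>0. \<forall>A\<in>sets (history \<Omega> X t). \<forall>x\<in>S. \<forall>y\<in>S.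
          \<P>(\<omega> in \<Omega>. \<omega> \<in> A \<and> X t \<omega> = x \<and> X (t + h) \<omega> = y)
            = \<P>(\<omega> in \<Omega>. \<omega> \<in> A \<and> X t \<omega> = x) * P h x y)"

definition bass_states :: "nat \<Rightarrow> (nat \<Rightarrow> nat) set" where
  "bass_states M = {1..M} \<rightarrow>\<^sub>E {0, 1}"

definition bass_rate ::
  "nat \<Rightarrow> (nat \<Rightarrow> real) \<Rightarrow> (nat \<Rightarrow> nat \<Rightarrow> real) \<Rightarrow> (nat \<Rightarrow> nat) \<Rightarrow> nat \<Rightarrow> real" where
  "bass_rate M p q x j = p j + (\<Sum>k\<in>{1..M} - {j}. q k j * real (x k))"

text \<open>
  Each nonadopter \<open>j\<close> contributes its rate to the entry for the transition \<open>x \<rightarrow> x(j := 1)\<close> and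
  subtracts it from the diagonal entry; all other entries vanish.
\<close>

definition bass_generator ::
  "nat \<Rightarrow> (nat \<Rightarrow> real) \<Rightarrow> (nat \<Rightarrow> nat \<Rightarrow> real) \<Rightarrow> (nat \<Rightarrow> nat) \<Rightarrow> (nat \<Rightarrow> nat) \<Rightarrow> real" where
  "bass_generator M p q x y =
    (\<Sum>j\<in>{j\<in>{1..M}. x j = 0}.
      bass_rate M p q x j * (of_bool (y = x(j := 1)) - of_bool (y = x)))"

text \<open>
  \<open>q i j\<close> is the influence of \<open>i\<close> on \<open>j\<close>, and \<open>X t \<omega> j\<close> is the state of node \<open>j\<close> at time \<open>t\<close>.
\<close>

locale discrete_bass =
  ctmc \<Omega> "bass_states M" "bass_generator M p q" X
  for M :: nat and p :: "nat \<Rightarrow> real" and q :: "nat \<Rightarrow> nat \<Rightarrow> real"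
    and \<Omega> :: "'w measure" and X :: "real \<Rightarrow> 'w \<Rightarrow> nat \<Rightarrow> nat" +
  assumes p_nonneg: "j \<in> {1..M} \<Longrightarrow> p j \<ge> 0"
    and q_nonneg: "i \<in> {1..M} \<Longrightarrow> j \<in> {1..M} \<Longrightarrow> i \<noteq> j \<Longrightarrow> q i j \<ge> 0"
    and initial: "\<omega> \<in> space \<Omega> \<Longrightarrow> j \<in> {1..M} \<Longrightarrow> X 0 \<omega> j = 0"
    and adopters_remain:
      "\<omega> \<in> space \<Omega> \<Longrightarrow> j \<in> {1..M} \<Longrightarrow> 0 \<le> s \<Longrightarrow> s \<le> t \<Longrightarrow> X s \<omega> j = 1 \<Longrightarrow> X t \<omega> j = 1"

text \<open>The value is \<open>\<infinity>\<close> if there are never \<open>m\<close> adopters.\<close>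

definition hitting_time :: "nat \<Rightarrow> (real \<Rightarrow> 'w \<Rightarrow> nat \<Rightarrow> nat) \<Rightarrow> nat \<Rightarrow> 'w \<Rightarrow> ennreal" where
  "hitting_time M X m \<omega> = (INF s\<in>{s. 0 \<le> s \<and> m \<le> (\<Sum>j\<in>{1..M}. X s \<omega> j)}. ennreal s)"

definition inter_adoption_time ::
  "nat \<Rightarrow> (real \<Rightarrow> 'w \<Rightarrow> nat \<Rightarrow> nat) \<Rightarrow> nat \<Rightarrow> 'w \<Rightarrow> ennreal" where
  "inter_adoption_time M X i \<omega> =
    (if hitting_time M X i \<omega> = \<infinity> then \<infinity>
     else hitting_time M X i \<omega> - hitting_time M X (i - 1) \<omega>)"

definition adoption_time :: "nat \<Rightarrow> (real \<Rightarrow> 'w \<Rightarrow> nat \<Rightarrow> nat) \<Rightarrow> nat \<Rightarrow> 'w \<Rightarrow> ennreal" where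
  "adoption_time M X m \<omega> = (\<Sum>i\<in>{1..m}. inter_adoption_time M X i \<omega>)"

definition num_adopters :: "nat \<Rightarrow> (real \<Rightarrow> 'w \<Rightarrow> nat \<Rightarrow> nat) \<Rightarrow> real \<Rightarrow> 'w \<Rightarrow> nat" where
  "num_adopters M X t \<omega> = Max {m \<in> {0..M}. adoption_time M X m \<omega> \<le> ennreal t}"

definition expected_adopters ::
  "'w measure \<Rightarrow> nat \<Rightarrow> (real \<Rightarrow> 'w \<Rightarrow> nat \<Rightarrow> nat) \<Rightarrow> real \<Rightarrow> real" where
  "expected_adopters \<Omega> M X t = (\<integral>\<omega>. real (num_adopters M X t \<omega>) \<partial>\<Omega>)"

definition cdf_of :: "'w measure \<Rightarrow> ('w \<Rightarrow> ennreal) \<Rightarrow> real \<Rightarrow> real" where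
  "cdf_of \<Omega> T \<tau> = \<P>(\<omega> in \<Omega>. T \<omega> \<le> ennreal \<tau>)"

end

theory Submission
  imports Defs
begin

text \<open>
  Since \<open>n(t) = (\<Sum>m = 1..M. Prob (T\<^sub>m \<le> t))\<close> and each \<open>T\<^sub>m\<close> is a sum of independent times,
  replacing the distributions of network A by those of B one summand at a time gives the weak
  inequality. For strictness take \<open>m = j\<close>: exchanging the last summand \<open>t\<^sub>j\<close> increases the
  probability as soon as \<open>T\<^sub>j\<^sub>-\<^sub>1\<close> of B is below \<open>t\<close> with positive probability. This holds because
  \<open>t\<^sub>j\<close> of B is finite with positive probability, so a state with \<open>j\<close> adopters is reached at some
  time, and a finite-state Markov chain that visits a state with positive probability at one time
  does so at every positive time.
\<close>

section \<open>Positivity of state probabilities\<close>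

text \<open>Turns a statement about all sufficiently short steps into one about a step that fits a
  whole number of times into a given interval, so that steps can be chained up to a prescribed
  time.\<close>

lemma eventually_at_right_0_fraction:
  fixes t :: real
  assumes "eventually P (at_right 0)" and "0 < t"
  shows "\<exists>n::nat. 0 < n \<and> P (t / real n)"
proof -
  obtain d where d: "0 < d" "\<And>h. 0 < h \<Longrightarrow> h < d \<Longrightarrow> P h"
    using assms(1) by (auto simp: eventually_at_right_field)
  obtain n :: nat where n: "t / d < real n"
    using reals_Archimedean2 by blast
  have "0 < real n"
    using n assms(2) d(1) by (smt (verit) divide_pos_pos)
  moreover have "P (t / real n)"
    using n d \<open>0 < real n\<close> assms(2) by (intro d(2)) (auto simp: field_simps)
  ultimately show ?thesis
    by auto
qed

context ctmc
begin

definition state_prob :: "real \<Rightarrow> 's \<Rightarrow> real" where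
  "state_prob t x = \<P>(\<omega> in \<Omega>. X t \<omega> = x)"

definition joint_prob :: "real \<Rightarrow> real \<Rightarrow> 's \<Rightarrow> 's \<Rightarrow> real" where
  "joint_prob t h x y = \<P>(\<omega> in \<Omega>. X t \<omega> = x \<and> X (t + h) \<omega> = y)"

lemma X_in_states: "0 \<le> t \<Longrightarrow> \<omega> \<in> space \<Omega> \<Longrightarrow> X t \<omega> \<in> S"
  using measurable_X[of t] by (auto dest: measurable_space)

lemma state_event [measurable]:
  assumes "0 \<le> t" shows "{\<omega> \<in> space \<Omega>. X t \<omega> \<in> U} \<in> events"
proof -
  have "X t -` (U \<inter> S) \<inter> space \<Omega> \<in> events"
    using measurable_X[OF assms] by (rule measurable_sets) auto
  also have "X t -` (U \<inter> S) \<inter> space \<Omega> = {\<omega> \<in> space \<Omega>. X t \<omega> \<in> U}"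
    using X_in_states[OF assms] by auto
  finally show ?thesis .
qed

lemma state_eq_event [measurable]:
  "0 \<le> t \<Longrightarrow> {\<omega> \<in> space \<Omega>. X t \<omega> = x} \<in> events"
  using state_event[of t "{x}"] by simp

lemma joint_event:
  "0 \<le> t \<Longrightarrow> 0 \<le> h \<Longrightarrow> {\<omega> \<in> space \<Omega>. X t \<omega> = x \<and> X (t + h) \<omega> = y} \<in> events"
  by (intro sets.sets_Collect_conj state_eq_event) auto

lemma joint_prob_le: "0 \<le> t \<Longrightarrow> 0 \<le> h \<Longrightarrow> joint_prob t h x y \<le> state_prob (t + h) y"
  unfolding joint_prob_def state_prob_def
  by (intro finite_measure_mono) (auto intro: state_eq_event)

text \<open>Choosing the whole space as the past event reduces the Markov property to pairs of
  times: mass at \<open>x\<close> is passed on to \<open>y\<close> by multiplication with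
  \<open>P h x y\<close>.\<close>

lemma transition_function:
  "\<exists>P. (\<forall>x\<in>S. \<forall>y\<in>S. ((\<lambda>h. (P h x y - of_bool (x = y)) / h) \<longlongrightarrow> Q x y) (at_right 0)) \<and>
    (\<forall>t\<ge>0. \<forall>h\<ge>0. \<forall>x\<in>S. \<forall>y\<in>S. joint_prob t h x y = state_prob t x * P h x y)"
proof -
  obtain P :: "real \<Rightarrow> 's \<Rightarrow> 's \<Rightarrow> real" where
    lim: "\<forall>x\<in>S. \<forall>y\<in>S. ((\<lambda>h. (P h x y - of_bool (x = y)) / h) \<longlongrightarrow> Q x y) (at_right 0)"
    and joint: "\<forall>t\<ge>0. \<forall>h\<ge>0. \<forall>A\<in>sets (history \<Omega> X t). \<forall>x\<in>S. \<forall>y\<in>S.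
          \<P>(\<omega> in \<Omega>. \<omega> \<in> A \<and> X t \<omega> = x \<and> X (t + h) \<omega> = y)
            = \<P>(\<omega> in \<Omega>. \<omega> \<in> A \<and> X t \<omega> = x) * P h x y"
    using markov by (elim exE conjE)
  have "joint_prob t h x y = state_prob t x * P h x y"
    if *: "0 \<le> t" "0 \<le> h" "x \<in> S" "y \<in> S" for t h x y
  proof -
    have "space \<Omega> \<in> sets (history \<Omega> X t)"
      unfolding history_def
      using sets.top[of "sigma (space \<Omega>) {X s -` B \<inter> space \<Omega> |s B. 0 \<le> s \<and> s \<le> t}"]
      by (simp add: space_measure_of_conv)
    then show ?thesis
      using joint[rule_format, OF *(1,2) _ *(3,4), of "space \<Omega>"]
      by (simp add: joint_prob_def state_prob_def)
  qed
  with lim show ?thesis by (intro exI[of _ P]) auto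
qed

text \<open>The diagonal entry \<open>P h x x\<close> tends to 1 as \<open>h\<close> tends to 0, so
  it is positive for short steps. Chaining \<open>n\<close> such steps, each starting and ending in
  \<open>x\<close>, covers the time from \<open>t\<close> to \<open>s\<close>.\<close>

lemma state_prob_persists:
  assumes x: "x \<in> S" and pos: "0 < state_prob t x" and t: "0 \<le> t" "t \<le> s"
  shows "0 < state_prob s x"
proof (cases "t = s")
  case False
  obtain P where
    lims: "\<forall>x\<in>S. \<forall>y\<in>S. ((\<lambda>h. (P h x y - of_bool (x = y)) / h) \<longlongrightarrow> Q x y) (at_right 0)"
    and joint: "\<forall>t\<ge>0. \<forall>h\<ge>0. \<forall>x\<in>S. \<forall>y\<in>S. joint_prob t h x y = state_prob t x * P h x y"
    using transition_function by (elim exE conjE)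
  have lim: "((\<lambda>h. (P h x x - 1) / h) \<longlongrightarrow> Q x x) (at_right 0)"
    using lims[rule_format, OF x x] by simp
  \<comment> \<open>For nonzero \<open>h\<close> this expression is \<open>P h x x\<close>; it is
    written so that the differentiability limit applies.\<close>
  have "((\<lambda>h. 1 + h * ((P h x x - 1) / h)) \<longlongrightarrow> 1 + 0 * Q x x) (at_right 0)"
    by (intro tendsto_intros lim)
  then have "eventually (\<lambda>h. 0 < 1 + h * ((P h x x - 1) / h)) (at_right 0)"
    by (rule order_tendstoD) auto
  then have "eventually (\<lambda>h. 0 < P h x x) (at_right 0)"
    using eventually_at_right_less[of "0::real"] by eventually_elim auto
  from eventually_at_right_0_fraction[OF this, of "s - t"]
  obtain n where n: "0 < n" "0 < P ((s - t) / real n) x x"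
    using False t by auto
  define h where "h = (s - t) / real n"
  have h: "0 \<le> h" "t + real n * h = s" "0 < P h x x"
    using n t by (auto simp: h_def)
  have "0 < state_prob (t + real k * h) x" for k
  proof (induction k)
    case (Suc k)
    have "0 < joint_prob (t + real k * h) h x x"
      using Suc joint[rule_format, of "t + real k * h" h x x] h t x by simp
    also have "\<dots> \<le> state_prob (t + real k * h + h) x"
      using h t by (intro joint_prob_le) auto
    finally show ?case
      by (simp add: algebra_simps)
  qed (use pos in simp)
  from this[of n] show ?thesis
    using h by simp
qed (use pos in simp)

text \<open>One short step suffices for the jump, since \<open>P h x y\<close> behaves like
  \<open>Q x y * h\<close>; the remaining time up to \<open>s\<close> is spent by persistence in
  \<open>y\<close>.\<close>

lemma state_prob_spreads:
  assumes "x \<in> S" "y \<in> S" "x \<noteq> y" and Q: "0 < Q x y"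
    and pos: "0 < state_prob t x" and t: "0 \<le> t" "t < s"
  shows "0 < state_prob s y"
proof -
  obtain P where
    lims: "\<forall>x\<in>S. \<forall>y\<in>S. ((\<lambda>h. (P h x y - of_bool (x = y)) / h) \<longlongrightarrow> Q x y) (at_right 0)"
    and joint: "\<forall>t\<ge>0. \<forall>h\<ge>0. \<forall>x\<in>S. \<forall>y\<in>S. joint_prob t h x y = state_prob t x * P h x y"
    using transition_function by (elim exE conjE)
  have lim: "((\<lambda>h. P h x y / h) \<longlongrightarrow> Q x y) (at_right 0)"
    using lims[rule_format, of x y] assms(1-3) by simp
  have "eventually (\<lambda>h. 0 < P h x y / h) (at_right 0)"
    using lim Q by (rule order_tendstoD)
  then have "eventually (\<lambda>h. 0 < P h x y) (at_right 0)"
    using eventually_at_right_less[of "0::real"] by eventually_elim (auto simp: zero_less_divide_iff)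
  from eventually_at_right_0_fraction[OF this, of "s - t"]
  obtain n where n: "0 < n" "0 < P ((s - t) / real n) x y"
    using t by auto
  define h where "h = (s - t) / real n"
  have h: "0 < h" "t + h \<le> s" "0 < P h x y"
    using n t mult_left_mono[of 1 "real n" "s - t"] by (auto simp: h_def field_simps)
  have "0 < joint_prob t h x y"
    using joint[rule_format, of t h x y] h t pos assms by simp
  also have "\<dots> \<le> state_prob (t + h) y"
    using h t by (intro joint_prob_le) auto
  finally show ?thesis
    using assms h t by (intro state_prob_persists[of y "t + h" s]) auto
qed

text \<open>The bound is uniform in \<open>t\<close> because the time enters only through the factor
  \<open>state_prob t x\<close>, which is at most 1.\<close>

lemma joint_prob_small:
  assumes "x \<in> S" "y \<in> S" "x \<noteq> y" and Q: "Q x y \<le> 0" and e: "0 < e"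
  shows "eventually (\<lambda>h. \<forall>t\<ge>0. joint_prob t h x y \<le> e * h) (at_right 0)"
proof -
  obtain P where
    lims: "\<forall>x\<in>S. \<forall>y\<in>S. ((\<lambda>h. (P h x y - of_bool (x = y)) / h) \<longlongrightarrow> Q x y) (at_right 0)"
    and joint: "\<forall>t\<ge>0. \<forall>h\<ge>0. \<forall>x\<in>S. \<forall>y\<in>S. joint_prob t h x y = state_prob t x * P h x y"
    using transition_function by (elim exE conjE)
  have lim: "((\<lambda>h. P h x y / h) \<longlongrightarrow> Q x y) (at_right 0)"
    using lims[rule_format, of x y] assms(1-3) by simp
  have "eventually (\<lambda>h. P h x y / h < e) (at_right 0)"
    using lim by (rule order_tendstoD) (use Q e in simp)
  then show ?thesis
    using eventually_at_right_less[of "0::real"]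
  proof eventually_elim
    case (elim h)
    show ?case
    proof (intro allI impI)
      fix t :: real assume "0 \<le> t"
      then have "joint_prob t h x y = state_prob t x * P h x y"
        using joint elim assms by simp
      also have "\<dots> \<le> state_prob t x * (e * h)"
        using elim by (intro mult_left_mono) (auto simp: field_simps state_prob_def)
      also have "\<dots> \<le> 1 * (e * h)"
        using elim e by (intro mult_right_mono) (auto simp: state_prob_def)
      finally show "joint_prob t h x y \<le> e * h" by simp
    qed
  qed
qed

text \<open>
  During a step of length \<open>h\<close> only a mass \<open>o(h)\<close> escapes from \<open>R\<close>, uniformly in the starting time,
  so cutting \<open>[0, t]\<close> into \<open>n\<close> equal steps shows that the mass outside \<open>R\<close> stays zero.
\<close>

lemma closed_set_not_left:
  assumes "finite S" and R: "R \<subseteq> S"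
    and closed: "\<And>x y. x \<in> R \<Longrightarrow> y \<in> S - R \<Longrightarrow> Q x y \<le> 0"
    and init: "\<P>(\<omega> in \<Omega>. X 0 \<omega> \<notin> R) = 0" and "0 \<le> t"
  shows "\<P>(\<omega> in \<Omega>. X t \<omega> \<notin> R) = 0"
proof (cases "t = 0")
  case False
  define f where "f s = \<P>(\<omega> in \<Omega>. X s \<omega> \<notin> R)" for s
  define Z where "Z = R \<times> (S - R)"
  have fin: "finite Z"
    using assms(1) R by (auto simp: Z_def intro: finite_subset)
  \<comment> \<open>If the chain is outside \<open>R\<close> at \<open>s + h\<close>, it was outside
    already at \<open>s\<close> or has made one of the finitely many escapes listed in
    \<open>Z\<close>.\<close>
  have step: "f (s + h) \<le> f s + (\<Sum>(x, y)\<in>Z. joint_prob s h x y)" if "0 \<le> s" "0 \<le> h" for s h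
  proof -
    have out: "{\<omega> \<in> space \<Omega>. X s \<omega> \<notin> R} \<in> events"
      using state_event[of s "- R"] that by simp
    have ev: "(\<lambda>(x, y). {\<omega> \<in> space \<Omega>. X s \<omega> = x \<and> X (s + h) \<omega> = y}) ` Z \<subseteq> events"
      using that joint_event by auto
    then have un: "(\<Union>(x, y)\<in>Z. {\<omega> \<in> space \<Omega>. X s \<omega> = x \<and> X (s + h) \<omega> = y}) \<in> events"
      using fin by (intro sets.finite_UN) auto
    have "f (s + h) \<le> prob ({\<omega> \<in> space \<Omega>. X s \<omega> \<notin> R} \<union>
        (\<Union>(x, y)\<in>Z. {\<omega> \<in> space \<Omega>. X s \<omega> = x \<and> X (s + h) \<omega> = y}))"
      unfolding f_def using that out un X_in_states[of "s + h"]
      by (intro finite_measure_mono sets.Un) (auto simp: Z_def)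
    also have "\<dots> \<le> f s + prob (\<Union>(x, y)\<in>Z. {\<omega> \<in> space \<Omega>. X s \<omega> = x \<and> X (s + h) \<omega> = y})"
      unfolding f_def using out un by (rule measure_Un_le)
    also have "\<dots> \<le> f s + (\<Sum>(x, y)\<in>Z. joint_prob s h x y)"
      using finite_measure_subadditive_finite[OF fin ev]
      by (simp add: joint_prob_def case_prod_unfold)
    finally show ?thesis .
  qed
  have bound: "f t \<le> real (card Z) * e * t" if e: "0 < e" for e
  proof -
    have "eventually (\<lambda>h. \<forall>z\<in>Z. \<forall>s\<ge>0. joint_prob s h (fst z) (snd z) \<le> e * h) (at_right 0)"
      using fin R closed e by (intro eventually_ball_finite ballI joint_prob_small) (auto simp: Z_def)
    moreover have "0 < t"
      using False \<open>0 \<le> t\<close> by simp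
    ultimately have "\<exists>n::nat. 0 < n \<and> (\<forall>z\<in>Z. \<forall>s\<ge>0.
        joint_prob s (t / real n) (fst z) (snd z) \<le> e * (t / real n))"
      by (rule eventually_at_right_0_fraction)
    then obtain n :: nat where n: "0 < n"
      "\<forall>z\<in>Z. \<forall>s\<ge>0. joint_prob s (t / real n) (fst z) (snd z) \<le> e * (t / real n)"
      by (elim exE conjE)
    define h where "h = t / real n"
    have h: "0 \<le> h" "real n * h = t"
      using n \<open>0 \<le> t\<close> by (auto simp: h_def)
    have small: "joint_prob s h (fst z) (snd z) \<le> e * h" if "z \<in> Z" "0 \<le> s" for s z
      unfolding h_def using n(2) that by blast
    have "f (real k * h) \<le> real k * (real (card Z) * (e * h))" for k
    proof (induction k)
      case 0
      then show ?case using init by (simp add: f_def)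
    next
      case (Suc k)
      have "f (real (Suc k) * h) = f (real k * h + h)"
        by (simp add: algebra_simps)
      also have "\<dots> \<le> f (real k * h) + (\<Sum>(x, y)\<in>Z. joint_prob (real k * h) h x y)"
        using h by (intro step) auto
      also have "(\<Sum>(x, y)\<in>Z. joint_prob (real k * h) h x y) \<le> (\<Sum>z\<in>Z. e * h)"
        using h by (intro sum_mono) (auto simp: case_prod_unfold intro!: small)
      finally show ?case
        using Suc by (simp add: algebra_simps)
    qed
    then have "f (real n * h) \<le> real n * (real (card Z) * (e * h))" .
    also have "\<dots> = real (card Z) * e * (real n * h)"
      by (simp add: ac_simps)
    finally show ?thesis
      unfolding h(2) .
  qed
  have "f t \<le> 0 + e" if "0 < e" for e
  proof -
    \<comment> \<open>Rescaling by \<open>c\<close> turns the bound into \<open>e\<close>; the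
      summand 1 keeps \<open>c\<close> positive even when \<open>Z\<close> is empty.\<close>
    define c where "c = real (card Z) * t + 1"
    have c: "0 < c" "real (card Z) * t \<le> c"
      using \<open>0 \<le> t\<close> by (auto simp: c_def add_nonneg_pos)
    have "f t \<le> (real (card Z) * t) * (e / c)"
      using bound[of "e / c"] that c by (simp add: algebra_simps)
    also have "\<dots> \<le> c * (e / c)"
      using c that by (intro mult_right_mono) auto
    finally show ?thesis using c by simp
  qed
  then have "f t \<le> 0"
    by (rule field_le_epsilon)
  then show ?thesis
    by (simp add: f_def measure_le_0_iff)
qed (use init in simp)

text \<open>
  Levy's dichotomy. The set \<open>R\<close> in the proof is closed under transitions of positive rate because
  half of the available time can be kept for the last transition.
\<close>

lemma state_prob_pos_all_times:
  assumes fin: "finite S" and pos: "0 < state_prob t x" and "0 \<le> t" "0 < s"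
  shows "0 < state_prob s x"
proof (rule ccontr)
  assume neg: "\<not> 0 < state_prob s x"
  define R where "R = {x \<in> S. \<forall>s>0. 0 < state_prob s x}"
  have init: "\<P>(\<omega> in \<Omega>. X 0 \<omega> \<notin> R) = 0"
  proof -
    \<comment> \<open>A state charged at time 0 stays charged at all later times by persistence, and
      so belongs to \<open>R\<close>.\<close>
    have null: "state_prob 0 y = 0" if "y \<in> S - R" for y
      using that state_prob_persists[of y 0]
      by (force simp: R_def state_prob_def zero_less_measure_iff)
    have "\<P>(\<omega> in \<Omega>. X 0 \<omega> \<notin> R) = prob (\<Union>y\<in>S - R. {\<omega> \<in> space \<Omega>. X 0 \<omega> = y})"
      using X_in_states[of 0] by (intro arg_cong[where f = prob]) auto
    also have "\<dots> \<le> (\<Sum>y\<in>S - R. state_prob 0 y)"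
      unfolding state_prob_def using fin state_eq_event
      by (intro finite_measure_subadditive_finite) auto
    also have "\<dots> = 0"
      using null by (intro sum.neutral) auto
    finally show ?thesis by (simp add: measure_le_0_iff)
  qed
  have "\<P>(\<omega> in \<Omega>. X t \<omega> \<notin> R) = 0"
  proof (rule closed_set_not_left[OF fin _ _ init \<open>0 \<le> t\<close>])
    fix x y assume xy: "x \<in> R" "y \<in> S - R"
    show "Q x y \<le> 0"
    proof (rule ccontr)
      assume "\<not> Q x y \<le> 0"
      then have "0 < state_prob r y" if "0 < r" for r
        using xy that by (intro state_prob_spreads[of x y "r / 2" r]) (auto simp: R_def)
      then show False using xy by (auto simp: R_def)
    qed
  qed (auto simp: R_def)
  \<comment> \<open>The state \<open>x\<close> lies outside \<open>R\<close> because its probability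
    vanishes at the positive time \<open>s\<close>.\<close>
  moreover have "state_prob t x \<le> \<P>(\<omega> in \<Omega>. X t \<omega> \<notin> R)"
    unfolding state_prob_def using neg \<open>0 < s\<close> \<open>0 \<le> t\<close> state_event[of t "- R"]
    by (intro finite_measure_mono) (auto simp: R_def)
  ultimately show False using pos by simp
qed

end

section \<open>Sums of independent waiting times\<close>

text \<open>The distribution function of the convolution of the two laws, written as a product
  measure so that either coordinate can be integrated out first. The laws live on
  \<open>ennreal\<close> because a waiting time may be infinite.\<close>

definition sum_le :: "ennreal measure \<Rightarrow> ennreal measure \<Rightarrow> ennreal \<Rightarrow> ennreal" where
  "sum_le \<mu> \<nu> s = emeasure (\<mu> \<Otimes>\<^sub>M \<nu>) {z. fst z + snd z \<le> s}"

abbreviation borel_prob :: "ennreal measure \<Rightarrow> bool" where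
  "borel_prob \<mu> \<equiv> prob_space \<mu> \<and> sets \<mu> = sets borel"

text \<open>Makes slices accessible to distribution functions. The case \<open>x > s\<close> is
  separate because subtraction truncates: there \<open>{..s - x}\<close> would be the singleton of 0
  instead of the empty set.\<close>

lemma add_le_slice:
  fixes x s :: ennreal
  assumes "s < top"
  shows "{y. x + y \<le> s} = (if x \<le> s then {..s - x} else {})"
proof (cases "x \<le> s")
  case True
  then have "x + y \<le> s \<longleftrightarrow> y \<le> s - x" for y
    using assms True
    by (auto simp: ennreal_le_minus_iff add.commute diff_eq_0_iff_ennreal less_top)
  then show ?thesis using True by auto
next
  case False
  then have "\<not> x + y \<le> s" for y
    using order_trans[of x "x + y" s] by auto
  then show ?thesis using False by auto
qed

lemma sum_le_event:
  assumes "borel_prob \<mu>" "borel_prob \<nu>"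
  shows "{z. fst z + snd z \<le> s} \<in> sets (\<mu> \<Otimes>\<^sub>M \<nu>)"
proof -
  have "{z \<in> space (borel \<Otimes>\<^sub>M borel). fst z + snd z \<le> (s :: ennreal)} \<in> sets (borel \<Otimes>\<^sub>M borel)"
    by measurable
  moreover have "sets (\<mu> \<Otimes>\<^sub>M \<nu>) = sets (borel \<Otimes>\<^sub>M borel)"
    using assms by (intro sets_pair_measure_cong) auto
  ultimately show ?thesis
    by (simp add: space_pair_measure)
qed

lemma
  assumes \<mu>: "borel_prob \<mu>" and \<nu>: "borel_prob \<nu>"
  shows sum_le_slices: "sum_le \<mu> \<nu> s = (\<integral>\<^sup>+x. emeasure \<nu> {y. x + y \<le> s} \<partial>\<mu>)"
    and slices_measurable: "(\<lambda>x. emeasure \<nu> {y. x + y \<le> s}) \<in> borel_measurable \<mu>"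
    and sum_le_commute: "sum_le \<mu> \<nu> s = sum_le \<nu> \<mu> s"
proof -
  \<comment> \<open>Stated for arbitrary laws so that it can also be applied with the two exchanged,
    which gives symmetry by Tonelli.\<close>
  have slices: "sum_le \<mu> \<nu> s = (\<integral>\<^sup>+x. emeasure \<nu> {y. x + y \<le> s} \<partial>\<mu>)"
    "(\<lambda>x. emeasure \<nu> {y. x + y \<le> s}) \<in> borel_measurable \<mu>"
    if *: "borel_prob \<mu>" "borel_prob \<nu>" for \<mu> \<nu> :: "ennreal measure"
  proof -
    interpret N: prob_space \<nu> using * by simp
    show "sum_le \<mu> \<nu> s = (\<integral>\<^sup>+x. emeasure \<nu> {y. x + y \<le> s} \<partial>\<mu>)"
      unfolding sum_le_def
      by (simp add: N.emeasure_pair_measure_alt[OF sum_le_event[OF *]] vimage_def)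
    show "(\<lambda>x. emeasure \<nu> {y. x + y \<le> s}) \<in> borel_measurable \<mu>"
      using N.measurable_emeasure_Pair[OF sum_le_event[OF *]] by (simp add: vimage_def)
  qed
  interpret M: prob_space \<mu> using \<mu> by simp
  interpret N: prob_space \<nu> using \<nu> by simp
  interpret pair_sigma_finite \<mu> \<nu> ..
  have "sum_le \<mu> \<nu> s = (\<integral>\<^sup>+y. emeasure \<mu> {x. y + x \<le> s} \<partial>\<nu>)"
    unfolding sum_le_def
    by (simp add: emeasure_pair_measure_alt2[OF sum_le_event[OF \<mu> \<nu>]] vimage_def add.commute)
  then show "sum_le \<mu> \<nu> s = sum_le \<nu> \<mu> s"
    using slices[OF \<nu> \<mu>] by simp
  show "sum_le \<mu> \<nu> s = (\<integral>\<^sup>+x. emeasure \<nu> {y. x + y \<le> s} \<partial>\<mu>)"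
    "(\<lambda>x. emeasure \<nu> {y. x + y \<le> s}) \<in> borel_measurable \<mu>"
    using slices[OF \<mu> \<nu>] by auto
qed

lemma slice_mono:
  fixes x s :: ennreal
  assumes "s < top" and "\<And>r. r < top \<Longrightarrow> emeasure \<nu> {..r} \<le> emeasure \<nu>' {..r}"
  shows "emeasure \<nu> {y. x + y \<le> s} \<le> emeasure \<nu>' {y. x + y \<le> s}"
  using assms(1) assms(2)[of "s - x"] by (simp add: add_le_slice diff_less_top_ennreal)

lemma sum_le_mono_right:
  assumes "borel_prob \<mu>" "borel_prob \<nu>" "borel_prob \<nu>'" "s < top"
    and "\<And>r. r < top \<Longrightarrow> emeasure \<nu> {..r} \<le> emeasure \<nu>' {..r}"
  shows "sum_le \<mu> \<nu> s \<le> sum_le \<mu> \<nu>' s"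
  using assms by (simp add: sum_le_slices nn_integral_mono slice_mono)

text \<open>The summands are exchanged one at a time; by symmetry each can be brought to the
  right-hand position for its exchange.\<close>

lemma sum_le_mono:
  assumes "borel_prob \<mu>" "borel_prob \<mu>'" "borel_prob \<nu>" "borel_prob \<nu>'" "s < top"
    and "\<And>r. r < top \<Longrightarrow> emeasure \<mu> {..r} \<le> emeasure \<mu>' {..r}"
    and "\<And>r. r < top \<Longrightarrow> emeasure \<nu> {..r} \<le> emeasure \<nu>' {..r}"
  shows "sum_le \<mu> \<nu> s \<le> sum_le \<mu>' \<nu>' s"
proof -
  have "sum_le \<mu> \<nu> s = sum_le \<nu> \<mu> s"
    using assms by (intro sum_le_commute)
  also have "\<dots> \<le> sum_le \<nu> \<mu>' s"
    using assms by (intro sum_le_mono_right)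
  also have "\<dots> = sum_le \<mu>' \<nu> s"
    using assms by (intro sum_le_commute)
  also have "\<dots> \<le> sum_le \<mu>' \<nu>' s"
    using assms by (intro sum_le_mono_right)
  finally show ?thesis .
qed

text \<open>For every \<open>x < s\<close> the remainder \<open>s - x\<close> is positive and
  finite, so the slices differ strictly there, and these \<open>x\<close> carry positive mass. At
  \<open>x = s\<close> the remainder is 0, where only the weak inequality is available; hence
  \<open>{..<s}\<close> in the last assumption.\<close>

lemma sum_le_strict_mono_right:
  assumes \<mu>: "borel_prob \<mu>" and \<nu>: "borel_prob \<nu>" and \<nu>': "borel_prob \<nu>'" and s: "s < top"
    and le: "\<And>r. r < top \<Longrightarrow> emeasure \<nu> {..r} \<le> emeasure \<nu>' {..r}"
    and less: "\<And>r. 0 < r \<Longrightarrow> r < top \<Longrightarrow> emeasure \<nu> {..r} < emeasure \<nu>' {..r}"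
    and pos: "0 < emeasure \<mu> {..<s}"
  shows "sum_le \<mu> \<nu> s < sum_le \<mu> \<nu>' s"
proof -
  interpret M: prob_space \<mu> using \<mu> by simp
  interpret N: prob_space \<nu> using \<nu> by simp
  have space: "space \<mu> = UNIV"
    using \<mu> sets_eq_imp_space_eq[of \<mu> borel] by simp
  \<comment> \<open>Strict comparison of the integrals requires the smaller one to be
    finite.\<close>
  have "(\<integral>\<^sup>+x. emeasure \<nu> {y. x + y \<le> s} \<partial>\<mu>) \<le> (\<integral>\<^sup>+x. 1 \<partial>\<mu>)"
    by (intro nn_integral_mono N.emeasure_le_1)
  then have fin: "(\<integral>\<^sup>+x. emeasure \<nu> {y. x + y \<le> s} \<partial>\<mu>) \<noteq> \<infinity>"
    by (auto simp: M.emeasure_space_1 top_unique)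
  have "\<not> (AE x in \<mu>. emeasure \<nu>' {y. x + y \<le> s} \<le> emeasure \<nu> {y. x + y \<le> s})"
  proof
    assume "AE x in \<mu>. emeasure \<nu>' {y. x + y \<le> s} \<le> emeasure \<nu> {y. x + y \<le> s}"
    then have "AE x in \<mu>. x \<notin> {..<s}"
    proof (rule AE_mp, intro AE_I2 impI notI)
      fix x assume *: "emeasure \<nu>' {y. x + y \<le> s} \<le> emeasure \<nu> {y. x + y \<le> s}" "x \<in> {..<s}"
      then have "emeasure \<nu> {..s - x} < emeasure \<nu>' {..s - x}"
        using s by (intro less) (auto simp: diff_gr0_ennreal diff_less_top_ennreal)
      then show False
        using * s by (simp add: add_le_slice order.strict_implies_order not_le[symmetric])
    qed
    then have "emeasure \<mu> {..<s} = 0"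
      using \<mu> space by (subst (asm) AE_iff_measurable[where N = "{..<s}"]) auto
    then show False using pos by simp
  qed
  then show ?thesis
    unfolding sum_le_slices[OF \<mu> \<nu>] sum_le_slices[OF \<mu> \<nu>']
    using slices_measurable[OF \<mu> \<nu>] slices_measurable[OF \<mu> \<nu>'] fin slice_mono[OF s le]
    by (intro nn_integral_less) auto
qed

section \<open>From product measures to independent random variables\<close>

context prob_space
begin

lemma borel_prob_distr: "random_variable borel X \<Longrightarrow> borel_prob (distr M borel X)"
  by (simp add: prob_space_distr)

lemma emeasure_distr_atMost:
  "random_variable borel X \<Longrightarrow> emeasure (distr M borel X) {..r} = \<P>(\<omega> in M. X \<omega> \<le> (r :: ennreal))"
  by (simp add: emeasure_distr emeasure_eq_measure vimage_def Int_def conj_commute)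

text \<open>Independence makes the joint law of \<open>X\<close> and \<open>Y\<close> the product of
  their laws.\<close>

lemma prob_add_le:
  fixes X Y :: "'a \<Rightarrow> ennreal"
  assumes "indep_var borel X borel Y"
  shows "ennreal (\<P>(\<omega> in M. X \<omega> + Y \<omega> \<le> s)) = sum_le (distr M borel X) (distr M borel Y) s"
proof -
  have rv [measurable]: "random_variable borel X" "random_variable borel Y"
    using assms by (auto dest: indep_var_rv1 indep_var_rv2)
  have "sum_le (distr M borel X) (distr M borel Y) s =
      emeasure (distr M (borel \<Otimes>\<^sub>M borel) (\<lambda>\<omega>. (X \<omega>, Y \<omega>))) {z. fst z + snd z \<le> s}"
    using assms by (simp add: sum_le_def indep_var_distribution_eq)
  also have "\<dots> = emeasure M ((\<lambda>\<omega>. (X \<omega>, Y \<omega>)) -` {z. fst z + snd z \<le> s} \<inter> space M)"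
  proof (rule emeasure_distr)
    show "{z. fst z + snd z \<le> s} \<in> sets (borel \<Otimes>\<^sub>M borel)"
      using sum_le_event[OF borel_prob_distr[OF rv(1)] borel_prob_distr[OF rv(2)], of s]
      by (simp cong: sets_pair_measure_cong)
  qed measurable
  also have "\<dots> = \<P>(\<omega> in M. X \<omega> + Y \<omega> \<le> s)"
    by (simp add: emeasure_eq_measure vimage_def Int_def conj_commute)
  finally show ?thesis by simp
qed

text \<open>The two variables are functions of the disjoint index blocks \<open>{1..m}\<close> and
  \<open>{Suc m}\<close>.\<close>

lemma indep_var_partial_sum:
  fixes T :: "nat \<Rightarrow> 'a \<Rightarrow> ennreal"
  assumes indep: "indep_vars (\<lambda>_. borel) T {1..N}" and "m < N"
  shows "indep_var borel (\<lambda>\<omega>. \<Sum>i\<in>{1..m}. T i \<omega>) borel (T (Suc m))"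
proof -
  have "indep_var
    borel ((\<lambda>f. \<Sum>i\<in>{1..m}. f i) \<circ> (\<lambda>\<omega>. restrict (\<lambda>i. T i \<omega>) {1..m}))
    borel ((\<lambda>f. f (Suc m)) \<circ> (\<lambda>\<omega>. restrict (\<lambda>i. T i \<omega>) {Suc m}))"
    using \<open>m < N\<close> by (intro indep_var_compose[OF indep_var_restrict[OF indep]]) auto
  also have "(\<lambda>f. f (Suc m)) \<circ> (\<lambda>\<omega>. restrict (\<lambda>i. T i \<omega>) {Suc m}) = T (Suc m)"
    by auto
  also have "(\<lambda>f. \<Sum>i\<in>{1..m}. f i) \<circ> (\<lambda>\<omega>. restrict (\<lambda>i. T i \<omega>) {1..m}) =
      (\<lambda>\<omega>. \<Sum>i\<in>{1..m}. T i \<omega>)"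
    by (auto cong: rev_conj_cong)
  finally show ?thesis .
qed

end

text \<open>Induction on the number of summands, for all bounds \<open>s\<close> simultaneously:
  \<open>sum_le_mono\<close> compares entire distribution functions, including that of the shorter
  sum. The empty sum is 0 and gives probability 1 on both sides.\<close>

lemma partial_sum_prob_mono:
  fixes T :: "nat \<Rightarrow> 'a \<Rightarrow> ennreal" and U :: "nat \<Rightarrow> 'b \<Rightarrow> ennreal"
  assumes "prob_space A" "prob_space B"
    and T: "prob_space.indep_vars A (\<lambda>_. borel) T {1..N}"
    and U: "prob_space.indep_vars B (\<lambda>_. borel) U {1..N}"
    and le: "\<And>i r. i \<in> {1..N} \<Longrightarrow> r < top \<Longrightarrow> \<P>(\<omega> in A. T i \<omega> \<le> r) \<le> \<P>(\<omega> in B. U i \<omega> \<le> r)"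
    and "m \<le> N" "s < top"
  shows "\<P>(\<omega> in A. (\<Sum>i\<in>{1..m}. T i \<omega>) \<le> s) \<le> \<P>(\<omega> in B. (\<Sum>i\<in>{1..m}. U i \<omega>) \<le> s)"
  using \<open>m \<le> N\<close> \<open>s < top\<close>
proof (induction m arbitrary: s)
  case 0
  then show ?case
    using assms(1,2) by (simp add: prob_space.prob_space)
next
  case (Suc m)
  interpret A: prob_space A by fact
  interpret B: prob_space B by fact
  have iT: "A.indep_var borel (\<lambda>\<omega>. \<Sum>i\<in>{1..m}. T i \<omega>) borel (T (Suc m))"
    using A.indep_var_partial_sum[OF T] Suc.prems by simp
  have iU: "B.indep_var borel (\<lambda>\<omega>. \<Sum>i\<in>{1..m}. U i \<omega>) borel (U (Suc m))"
    using B.indep_var_partial_sum[OF U] Suc.prems by simp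
  note rv = A.indep_var_rv1[OF iT] A.indep_var_rv2[OF iT] B.indep_var_rv1[OF iU] B.indep_var_rv2[OF iU]
  have "sum_le (distr A borel (\<lambda>\<omega>. \<Sum>i\<in>{1..m}. T i \<omega>)) (distr A borel (T (Suc m))) s
      \<le> sum_le (distr B borel (\<lambda>\<omega>. \<Sum>i\<in>{1..m}. U i \<omega>)) (distr B borel (U (Suc m))) s"
  proof (rule sum_le_mono[OF A.borel_prob_distr[OF rv(1)] B.borel_prob_distr[OF rv(3)]
      A.borel_prob_distr[OF rv(2)] B.borel_prob_distr[OF rv(4)]])
    fix r :: ennreal assume "r < top"
    then show "emeasure (distr A borel (\<lambda>\<omega>. \<Sum>i\<in>{1..m}. T i \<omega>)) {..r}
        \<le> emeasure (distr B borel (\<lambda>\<omega>. \<Sum>i\<in>{1..m}. U i \<omega>)) {..r}"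
      unfolding A.emeasure_distr_atMost[OF rv(1)] B.emeasure_distr_atMost[OF rv(3)]
      using Suc.IH[of r] Suc.prems by (intro ennreal_leI) auto
    show "emeasure (distr A borel (T (Suc m))) {..r} \<le> emeasure (distr B borel (U (Suc m))) {..r}"
      unfolding A.emeasure_distr_atMost[OF rv(2)] B.emeasure_distr_atMost[OF rv(4)]
      using le \<open>r < top\<close> Suc.prems by (intro ennreal_leI) auto
  qed (use Suc.prems in simp)
  then show ?case
    unfolding A.prob_add_le[OF iT, symmetric] B.prob_add_le[OF iU, symmetric]
    by simp
qed

text \<open>First the initial sum is exchanged while the last time of \<open>A\<close> is kept,
  which gives a weak inequality. Then the last time is exchanged against the fixed initial sum of
  \<open>B\<close>, which gives a strict one; this is why positivity is assumed for
  \<open>B\<close>.\<close>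

lemma partial_sum_prob_strict_mono:
  fixes T :: "nat \<Rightarrow> 'a \<Rightarrow> ennreal" and U :: "nat \<Rightarrow> 'b \<Rightarrow> ennreal"
  assumes "prob_space A" "prob_space B"
    and T: "prob_space.indep_vars A (\<lambda>_. borel) T {1..N}"
    and U: "prob_space.indep_vars B (\<lambda>_. borel) U {1..N}"
    and le: "\<And>i r. i \<in> {1..N} \<Longrightarrow> r < top \<Longrightarrow> \<P>(\<omega> in A. T i \<omega> \<le> r) \<le> \<P>(\<omega> in B. U i \<omega> \<le> r)"
    and m: "m < N" and s: "s < top"
    and less: "\<And>r. 0 < r \<Longrightarrow> r < top \<Longrightarrow>
      \<P>(\<omega> in A. T (Suc m) \<omega> \<le> r) < \<P>(\<omega> in B. U (Suc m) \<omega> \<le> r)"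
    and pos: "0 < \<P>(\<omega> in B. (\<Sum>i\<in>{1..m}. U i \<omega>) < s)"
  shows "\<P>(\<omega> in A. (\<Sum>i\<in>{1..Suc m}. T i \<omega>) \<le> s) < \<P>(\<omega> in B. (\<Sum>i\<in>{1..Suc m}. U i \<omega>) \<le> s)"
proof -
  interpret A: prob_space A by fact
  interpret B: prob_space B by fact
  have iT: "A.indep_var borel (\<lambda>\<omega>. \<Sum>i\<in>{1..m}. T i \<omega>) borel (T (Suc m))"
    using A.indep_var_partial_sum[OF T] m by simp
  have iU: "B.indep_var borel (\<lambda>\<omega>. \<Sum>i\<in>{1..m}. U i \<omega>) borel (U (Suc m))"
    using B.indep_var_partial_sum[OF U] m by simp
  note rv = A.indep_var_rv1[OF iT] A.indep_var_rv2[OF iT] B.indep_var_rv1[OF iU] B.indep_var_rv2[OF iU]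
  note bp = A.borel_prob_distr[OF rv(1)] A.borel_prob_distr[OF rv(2)]
    B.borel_prob_distr[OF rv(3)] B.borel_prob_distr[OF rv(4)]
  have last_le: "emeasure (distr A borel (T (Suc m))) {..r} \<le> emeasure (distr B borel (U (Suc m))) {..r}"
    if "r < top" for r
    unfolding A.emeasure_distr_atMost[OF rv(2)] B.emeasure_distr_atMost[OF rv(4)]
    using le that m by (intro ennreal_leI) auto
  have "sum_le (distr A borel (\<lambda>\<omega>. \<Sum>i\<in>{1..m}. T i \<omega>)) (distr A borel (T (Suc m))) s
      \<le> sum_le (distr B borel (\<lambda>\<omega>. \<Sum>i\<in>{1..m}. U i \<omega>)) (distr A borel (T (Suc m))) s"
  proof (rule sum_le_mono[OF bp(1) bp(3) bp(2) bp(2) s])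
    fix r :: ennreal assume "r < top"
    then show "emeasure (distr A borel (\<lambda>\<omega>. \<Sum>i\<in>{1..m}. T i \<omega>)) {..r}
        \<le> emeasure (distr B borel (\<lambda>\<omega>. \<Sum>i\<in>{1..m}. U i \<omega>)) {..r}"
      unfolding A.emeasure_distr_atMost[OF rv(1)] B.emeasure_distr_atMost[OF rv(3)]
      using partial_sum_prob_mono[OF assms(1,2) T U le, of m r] m by (intro ennreal_leI) auto
  qed simp
  also have "\<dots> < sum_le (distr B borel (\<lambda>\<omega>. \<Sum>i\<in>{1..m}. U i \<omega>)) (distr B borel (U (Suc m))) s"
  proof (rule sum_le_strict_mono_right[OF bp(3) bp(2) bp(4) s last_le])
    fix r :: ennreal assume "0 < r" "r < top"
    then show "emeasure (distr A borel (T (Suc m))) {..r} < emeasure (distr B borel (U (Suc m))) {..r}"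
      unfolding A.emeasure_distr_atMost[OF rv(2)] B.emeasure_distr_atMost[OF rv(4)]
      using less by (intro ennreal_lessI) (auto intro: le_less_trans[OF measure_nonneg])
  next
    show "0 < emeasure (distr B borel (\<lambda>\<omega>. \<Sum>i\<in>{1..m}. U i \<omega>)) {..<s}"
      using pos rv(3)
      by (simp add: emeasure_distr B.emeasure_eq_measure vimage_def Int_def conj_commute)
  qed
  finally show ?thesis
    unfolding A.prob_add_le[OF iT, symmetric] B.prob_add_le[OF iU, symmetric]
    by (simp add: ennreal_less_iff)
qed

section \<open>Adoption times\<close>

context discrete_bass
begin

abbreviation adopters :: "(nat \<Rightarrow> nat) \<Rightarrow> nat" where
  "adopters x \<equiv> \<Sum>j\<in>{1..M}. x j"

lemma finite_bass_states: "finite (bass_states M)"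
  unfolding bass_states_def by (intro finite_PiE) auto

lemma adopters_mono:
  assumes \<omega>: "\<omega> \<in> space \<Omega>" and s: "0 \<le> s" "s \<le> t"
  shows "adopters (X s \<omega>) \<le> adopters (X t \<omega>)"
proof (rule sum_mono)
  fix j assume j: "j \<in> {1..M}"
  have "X s \<omega> j \<in> {0, 1}"
    using X_in_states[OF s(1) \<omega>] j by (auto simp: bass_states_def PiE_iff)
  then show "X s \<omega> j \<le> X t \<omega> j"
    using adopters_remain[OF \<omega> j s] by auto
qed

lemma hitting_time_le:
  "0 \<le> s \<Longrightarrow> m \<le> adopters (X s \<omega>) \<Longrightarrow> hitting_time M X m \<omega> \<le> ennreal s"
  unfolding hitting_time_def by (intro INF_lower) auto

text \<open>The waiting times telescope, and monotonicity of the hitting times in \<open>m\<close>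
  lets each truncated difference be added back. An infinite hitting time makes the bound
  trivial.\<close>

lemma adoption_time_le_hitting_time:
  "adoption_time M X m \<omega> \<le> hitting_time M X m \<omega>"
proof (induction m)
  case (Suc m)
  show ?case
  proof (cases "hitting_time M X (Suc m) \<omega> = \<infinity>")
    case False
    have mono: "hitting_time M X m \<omega> \<le> hitting_time M X (Suc m) \<omega>"
      unfolding hitting_time_def by (intro INF_superset_mono) auto
    have "adoption_time M X (Suc m) \<omega> =
        adoption_time M X m \<omega> + (hitting_time M X (Suc m) \<omega> - hitting_time M X m \<omega>)"
      using False by (simp add: adoption_time_def inter_adoption_time_def)
    also have "\<dots> \<le> hitting_time M X m \<omega> + (hitting_time M X (Suc m) \<omega> - hitting_time M X m \<omega>)"
      using Suc by (intro add_right_mono)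
    also have "\<dots> = hitting_time M X (Suc m) \<omega>"
      using mono by simp
    finally show ?thesis .
  qed simp
qed (simp add: adoption_time_def)

text \<open>Otherwise almost surely no state with \<open>m\<close> or more adopters is seen at any
  natural time, a countable family of null events. As the number of adopters never decreases, no
  real time sees one either, so the waiting time is almost surely infinite.\<close>

lemma finite_inter_adoption_time_reaches:
  assumes pos: "0 < cdf_of \<Omega> (inter_adoption_time M X m) \<tau>"
  obtains n :: nat and x where "m \<le> adopters x" "0 < state_prob (real n) x"
proof -
  define F where "F = {x \<in> bass_states M. m \<le> adopters x}"
  have fin: "finite F"
    using finite_bass_states by (simp add: F_def)
  have "\<exists>n. \<exists>x\<in>F. 0 < state_prob (real n) x"
  proof (rule ccontr)
    assume "\<not> ?thesis"
    then have null: "state_prob (real n) x = 0" if "x \<in> F" for n x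
      using that by (auto simp: state_prob_def zero_less_measure_iff)
    have "AE \<omega> in \<Omega>. X (real n) \<omega> \<noteq> x" if "x \<in> F" for n x
      using null[OF that, of n] state_eq_event[of "real n" x]
      by (subst AE_iff_measurable[where N = "{\<omega> \<in> space \<Omega>. X (real n) \<omega> = x}"])
        (auto simp: state_prob_def emeasure_eq_measure)
    then have "AE \<omega> in \<Omega>. \<forall>n. \<forall>x\<in>F. X (real n) \<omega> \<noteq> x"
      using fin by (auto simp: AE_all_countable intro!: AE_finite_allI)
    then have "AE \<omega> in \<Omega>. \<not> inter_adoption_time M X m \<omega> \<le> ennreal \<tau>"
    proof (rule AE_mp, intro AE_I2 impI)
      fix \<omega> assume \<omega>: "\<omega> \<in> space \<Omega>" and never: "\<forall>n. \<forall>x\<in>F. X (real n) \<omega> \<noteq> x"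
      have "\<not> m \<le> adopters (X s \<omega>)" if s: "0 \<le> s" for s
      proof
        assume "m \<le> adopters (X s \<omega>)"
        also obtain n where n: "s \<le> real n"
          using real_arch_simple by blast
        then have "adopters (X s \<omega>) \<le> adopters (X (real n) \<omega>)"
          using \<omega> s by (intro adopters_mono) auto
        finally have "X (real n) \<omega> \<in> F"
          using X_in_states[of "real n" \<omega>] \<omega> by (simp add: F_def)
        then show False using never by auto
      qed
      then have "{s. 0 \<le> s \<and> m \<le> adopters (X s \<omega>)} = {}"
        by blast
      \<comment> \<open>The infimum of the empty set is the top element, which exceeds every
        \<open>ennreal \<tau>\<close>.\<close>
      then have "hitting_time M X m \<omega> = \<infinity>"
        unfolding hitting_time_def by (simp only: image_empty Inf_empty infinity_ennreal_def)
      then show "\<not> inter_adoption_time M X m \<omega> \<le> ennreal \<tau>"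
        by (simp add: inter_adoption_time_def top_unique)
    qed
    then have "cdf_of \<Omega> (inter_adoption_time M X m) \<tau> = 0"
      unfolding cdf_of_def by (intro prob_eq_0_AE)
    then show False using pos by simp
  qed
  then show ?thesis
    using that by (auto simp: F_def)
qed

lemma adoption_time_early:
  assumes pos: "0 < cdf_of \<Omega> (inter_adoption_time M X (Suc m)) \<tau>" and "0 < s"
    and meas: "adoption_time M X m \<in> borel_measurable \<Omega>"
  shows "0 < \<P>(\<omega> in \<Omega>. adoption_time M X m \<omega> < ennreal s)"
proof -
  obtain n :: nat and x where x: "Suc m \<le> adopters x" "0 < state_prob (real n) x"
    using finite_inter_adoption_time_reaches[OF pos] .
  \<comment> \<open>The state may first have been found at a late time \<open>n\<close>; positivity
    at all times moves it to \<open>s / 2\<close>, which leaves room for the strict bound by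
    \<open>s\<close>.\<close>
  have "0 < state_prob (s / 2) x"
    using \<open>0 < s\<close> by (intro state_prob_pos_all_times[OF finite_bass_states x(2)]) auto
  also have "\<dots> \<le> \<P>(\<omega> in \<Omega>. adoption_time M X m \<omega> < ennreal s)"
    unfolding state_prob_def
  proof (intro finite_measure_mono subsetI)
    fix \<omega> assume "\<omega> \<in> {\<omega> \<in> space \<Omega>. X (s / 2) \<omega> = x}"
    then have \<omega>: "\<omega> \<in> space \<Omega>" "X (s / 2) \<omega> = x" by auto
    have "adoption_time M X m \<omega> \<le> hitting_time M X m \<omega>"
      by (rule adoption_time_le_hitting_time)
    also have "\<dots> \<le> ennreal (s / 2)"
      using \<omega> x \<open>0 < s\<close> by (intro hitting_time_le) auto
    also have "\<dots> < ennreal s"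
      using \<open>0 < s\<close> by (intro ennreal_lessI) auto
    finally show "\<omega> \<in> {\<omega> \<in> space \<Omega>. adoption_time M X m \<omega> < ennreal s}"
      using \<omega> by simp
  qed (use meas in measurable)
  finally show ?thesis .
qed

end

section \<open>The expected number of adopters as a sum of probabilities\<close>

lemma num_adopters_eq:
  "num_adopters M X t \<omega> = (\<Sum>m\<in>{1..M}. of_bool (adoption_time M X m \<omega> \<le> ennreal t))"
proof -
  define K where "K = {m \<in> {0..M}. adoption_time M X m \<omega> \<le> ennreal t}"
  have K: "finite K" "0 \<in> K"
    by (auto simp: K_def adoption_time_def)
  \<comment> \<open>Waiting times are nonnegative, so \<open>K\<close> is an initial segment and its
    maximum can be found by counting.\<close>
  have down: "m \<in> K" if "n \<in> K" "m \<le> n" for m n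
  proof -
    have "adoption_time M X m \<omega> \<le> adoption_time M X n \<omega>"
      unfolding adoption_time_def using that by (intro sum_mono2) auto
    then show ?thesis
      using that by (auto simp: K_def)
  qed
  define k where "k = Max K"
  have "k \<in> K"
    unfolding k_def using K by (intro Max_in) auto
  have mem: "m \<in> K \<longleftrightarrow> m \<le> k" for m
  proof
    show "m \<in> K \<Longrightarrow> m \<le> k"
      unfolding k_def by (rule Max_ge[OF K(1)])
  qed (rule down[OF \<open>k \<in> K\<close>])
  have "K = {..k}"
    by (rule set_eqI) (simp only: mem atMost_iff)
  \<comment> \<open>Removing 0, which always lies in \<open>K\<close>, makes the count
    \<open>k\<close> instead of \<open>k + 1\<close>.\<close>
  then have "card (K - {0}) = card ({..k} - {0})"
    by (rule arg_cong)
  then have "k = card (K - {0})"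
    by simp
  also have "K - {0} = {m \<in> {1..M}. adoption_time M X m \<omega> \<le> ennreal t}"
    by (auto simp: K_def)
  also have "card \<dots> = (\<Sum>m\<in>{1..M}. of_bool (adoption_time M X m \<omega> \<le> ennreal t))"
    by (simp add: of_bool_def sum.If_cases Int_def)
  finally show ?thesis
    by (simp add: num_adopters_def K_def k_def)
qed

lemma (in prob_space) expected_adopters_eq:
  assumes [measurable]: "\<And>m. m \<in> {1..N} \<Longrightarrow> adoption_time N X m \<in> borel_measurable M"
  shows "expected_adopters M N X t = (\<Sum>m\<in>{1..N}. \<P>(\<omega> in M. adoption_time N X m \<omega> \<le> ennreal t))"
proof -
  have ev: "{\<omega> \<in> space M. adoption_time N X m \<omega> \<le> ennreal t} \<in> events" if "m \<in> {1..N}" for m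
    using assms[OF that] by measurable
  have "expected_adopters M N X t =
      (\<integral>\<omega>. (\<Sum>m\<in>{1..N}. indicator {\<omega> \<in> space M. adoption_time N X m \<omega> \<le> ennreal t} \<omega>) \<partial>M)"
    unfolding expected_adopters_def num_adopters_eq
    by (intro Bochner_Integration.integral_cong) (auto simp: indicator_def of_bool_def intro!: sum.cong)
  also have "\<dots> = (\<Sum>m\<in>{1..N}. \<integral>\<omega>. indicator {\<omega> \<in> space M. adoption_time N X m \<omega> \<le> ennreal t} \<omega> \<partial>M)"
    using ev by (intro Bochner_Integration.integral_sum) (auto simp: emeasure_eq_measure)
  also have "\<dots> = (\<Sum>m\<in>{1..N}. \<P>(\<omega> in M. adoption_time N X m \<omega> \<le> ennreal t))"
    using ev by (intro sum.cong) auto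
  finally show ?thesis .
qed

text \<open>Measurability of the waiting times is read off from \<open>indep_vars\<close>, not from
  the infimum over uncountably many times.\<close>

lemma (in prob_space) adoption_time_measurable:
  assumes "indep_vars (\<lambda>_. borel) (inter_adoption_time N X) {1..N}" and "m \<le> N"
  shows "adoption_time N X m \<in> borel_measurable M"
proof -
  have "(\<lambda>\<omega>. \<Sum>i\<in>{1..m}. inter_adoption_time N X i \<omega>) \<in> borel_measurable M"
    using assms by (intro borel_measurable_sum) (auto simp: indep_vars_def)
  then show ?thesis
    by (simp add: adoption_time_def[abs_def])
qed

theorem theorem2:
  fixes M :: nat
    and pA pB :: "nat \<Rightarrow> real" and qA qB :: "nat \<Rightarrow> nat \<Rightarrow> real"
    and \<Omega>A :: "'a measure" and XA :: "real \<Rightarrow> 'a \<Rightarrow> nat \<Rightarrow> nat"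
    and \<Omega>B :: "'b measure" and XB :: "real \<Rightarrow> 'b \<Rightarrow> nat \<Rightarrow> nat"
    and t :: real
  assumes bass_A: "discrete_bass M pA qA \<Omega>A XA"
    and bass_B: "discrete_bass M pB qB \<Omega>B XB"
    and indep_A: "prob_space.indep_vars \<Omega>A (\<lambda>_. borel) (inter_adoption_time M XA) {1..M}"
    and indep_B: "prob_space.indep_vars \<Omega>B (\<lambda>_. borel) (inter_adoption_time M XB) {1..M}"
    and cdf_le: "\<forall>i\<in>{1..M}. \<forall>\<tau>\<ge>0.
      cdf_of \<Omega>A (inter_adoption_time M XA i) \<tau> \<le> cdf_of \<Omega>B (inter_adoption_time M XB i) \<tau>"
    and cdf_less: "\<exists>j\<in>{1..M}. \<forall>\<tau>>0.
      cdf_of \<Omega>A (inter_adoption_time M XA j) \<tau> < cdf_of \<Omega>B (inter_adoption_time M XB j) \<tau>"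
    and t: "0 < t"
  shows "expected_adopters \<Omega>A M XA t < expected_adopters \<Omega>B M XB t"

proof -
  interpret A: discrete_bass M pA qA \<Omega>A XA by (fact bass_A)
  interpret B: discrete_bass M pB qB \<Omega>B XB by (fact bass_B)
  let ?T = "inter_adoption_time M XA" and ?U = "inter_adoption_time M XB"
  have le: "\<P>(\<omega> in \<Omega>A. ?T i \<omega> \<le> r) \<le> \<P>(\<omega> in \<Omega>B. ?U i \<omega> \<le> r)"
    if "i \<in> {1..M}" "r < top" for i and r :: ennreal
    using that cdf_le by (cases r) (auto simp: cdf_of_def)
  obtain j where j: "j \<in> {1..M}" and less: "\<And>\<tau>. 0 < \<tau> \<Longrightarrow> cdf_of \<Omega>A (?T j) \<tau> < cdf_of \<Omega>B (?U j) \<tau>"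
    using cdf_less by blast
  obtain m where m: "j = Suc m" "m < M"
    using j by (cases j) auto
  \<comment> \<open>The strict inequality at one positive time, here 1, already shows that this
    waiting time of \<open>B\<close> is finite with positive probability.\<close>
  have "0 \<le> cdf_of \<Omega>A (?T (Suc m)) 1"
    by (simp add: cdf_of_def)
  also have "\<dots> < cdf_of \<Omega>B (?U (Suc m)) 1"
    using less m by simp
  finally have "0 < \<P>(\<omega> in \<Omega>B. adoption_time M XB m \<omega> < ennreal t)"
    using m by (intro B.adoption_time_early t B.adoption_time_measurable[OF indep_B]) auto
  then have early: "0 < \<P>(\<omega> in \<Omega>B. (\<Sum>i\<in>{1..m}. ?U i \<omega>) < ennreal t)"
    by (simp add: adoption_time_def)
  have "\<P>(\<omega> in \<Omega>A. (\<Sum>i\<in>{1..Suc m}. ?T i \<omega>) \<le> ennreal t)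
      < \<P>(\<omega> in \<Omega>B. (\<Sum>i\<in>{1..Suc m}. ?U i \<omega>) \<le> ennreal t)"
  proof (rule partial_sum_prob_strict_mono[OF A.prob_space_axioms B.prob_space_axioms indep_A indep_B
        le m(2) _ _ early])
    fix r :: ennreal assume "0 < r" "r < top"
    then show "\<P>(\<omega> in \<Omega>A. ?T (Suc m) \<omega> \<le> r) < \<P>(\<omega> in \<Omega>B. ?U (Suc m) \<omega> \<le> r)"
      using less m by (cases r) (auto simp: cdf_of_def)
  qed (simp_all add: ennreal_less_top)
  then have strict: "\<P>(\<omega> in \<Omega>A. adoption_time M XA j \<omega> \<le> ennreal t)
      < \<P>(\<omega> in \<Omega>B. adoption_time M XB j \<omega> \<le> ennreal t)"
    by (simp only: adoption_time_def m(1))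
  have weak: "\<P>(\<omega> in \<Omega>A. adoption_time M XA i \<omega> \<le> ennreal t)
      \<le> \<P>(\<omega> in \<Omega>B. adoption_time M XB i \<omega> \<le> ennreal t)" if "i \<in> {1..M}" for i
    unfolding adoption_time_def
    using partial_sum_prob_mono[OF A.prob_space_axioms B.prob_space_axioms indep_A indep_B le,
        of i "ennreal t"] that by simp
  \<comment> \<open>The sums are compared term by term, with strictness at index
    \<open>j\<close>.\<close>
  have "expected_adopters \<Omega>A M XA t = (\<Sum>i\<in>{1..M}. \<P>(\<omega> in \<Omega>A. adoption_time M XA i \<omega> \<le> ennreal t))"
    by (intro A.expected_adopters_eq A.adoption_time_measurable[OF indep_A]) simp
  also have "\<dots> < (\<Sum>i\<in>{1..M}. \<P>(\<omega> in \<Omega>B. adoption_time M XB i \<omega> \<le> ennreal t))"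
    using strict weak j by (intro sum_strict_mono_ex1) auto
  also have "\<dots> = expected_adopters \<Omega>B M XB t"
    by (intro B.expected_adopters_eq[symmetric] B.adoption_time_measurable[OF indep_B]) simp
  finally show ?thesis .
qed

end
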